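(* Let $p$ be a positive integer. The following identities hold. (i) If $1\le m\le p-1$, then $\gamma_{p;(p-2)\mathbf e_0+\mathbf e_m}=\binom{p}{m+1}$. (ii) If $1\le m\le p$, then $\gamma_{p;(m-1)\mathbf e_0+(p-m)\mathbf e_1}={p\brace m}$. (iii) For $1\le m\le p$, $\displaystyle\sum_{\mathbf a\in\Lambda_p,\ \sum_i i\,\mathbf a(i)=p-m}\gamma_{p;\mathbf a}={p\brack m}$. (iv) For $0\le m\le p-1$, $\displaystyle\sum_{\mathbf a\in\Lambda_p,\ \mathbf a(0)=m}\gamma_{p;\mathbf a}=\left\langle{p\atop m}\right\rangle$.
   Context: ${p\brace m}$ is the Stirling number of the second kind (partitions of a $p$-set into exactly $m$ parts), ${p\brack m}$ the signless Stirling number of the first kind (permutations of a $p$-set with exactly $m$ cycles), and $\left\langle{p\atop m}\right\rangle$ the Eulerian number: the number of permutations $\pi\in S_p$ with exactly $m$ descents, i.e. $|\{i:1\le i<p,\ \pi_i>\pi_{i+1}\}|=m$. $D=\frac{d}{dx}$. $\mathbb N^{\infty}$ is the set of infinite vectors $\mathbf a=(\mathbf a(0),\mathbf a(1),\dots)$ of nonnegative integers, $\mathbf e_m(i)=\delta_{m,i}$, and $\Lambda_p=\{\mathbf a\in\mathbb N^{\infty}:\ \sum_i\mathbf a(i)=p-1,\ \sum_i i\,\mathbf a(i)<p\}$. The coefficients $\gamma_{p;\mathbf a}$ ($\mathbf a\in\Lambda_p$) are the constants, independent of $f$, determined by the operator identity $$(fD)^p=\sum_{\mathbf a\in\Lambda_p}\gamma_{p;\mathbf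 a}\,f\cdot\prod_{i\ge0}(f^{(i)})^{\mathbf a(i)}\,D^{\,p-\sum_i i\,\mathbf a(i)}$$ holding for every formal power series $f$ (over a field of characteristic $0$), where $f^{(0)}=f$, $f^{(i)}=D^if$, and $fD$ is the operator $h\mapsto f\cdot Dh$. *)

theory Defs
  imports
    "HOL-Computational_Algebra.Formal_Power_Series"
    "HOL-Combinatorics.Stirling"
    "HOL-Combinatorics.Permutations"
    "HOL-Combinatorics.Orbits"
    "HOL-Library.Disjoint_Sets"
begin

text \<open>
  The library defines \<^const>\<open>Stirling\<close> and \<^const>\<open>stirling\<close> by recurrence.
  \<open>card_partitions_eq_Stirling\<close> and \<open>card_permutations_eq_stirling\<close> below identify
  them with the number of set partitions with \<open>m\<close> parts and the number of permutations
  with \<open>m\<close> cycles; a fixed point counts as a cycle.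
\<close>

lemma card_partitions_insert:
  assumes A: "finite A" and a: "a \<notin> A"
  defines "S \<equiv> \<lambda>B k. {P. partition_on B P \<and> card P = k}"
  shows "card (S (insert a A) (Suc k)) = Suc k * card (S A (Suc k)) + card (S A k)"
proof -
  let ?f = "\<lambda>P. insert {a} P"
  let ?g = "\<lambda>(P, B). insert (insert a B) (P - {B})"
  let ?T = "SIGMA P : S A (Suc k). P"
  have fin: "finite (S A j)" for j
    unfolding S_def using finitely_many_partition_on[OF A] by (rule rev_finite_subset) auto
  have finP: "finite P" if "P \<in> S A j" for P j
    using that A finite_elements unfolding S_def by blast
  have sub: "B \<subseteq> A" if "P \<in> S A j" "B \<in> P" for P B j
    using that unfolding S_def partition_on_def by blast
  have eq: "S (insert a A) (Suc k) = ?f ` S A k \<union> ?g ` ?T" (is "?L = ?R")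
  proof (intro set_eqI iffI)
    fix Q assume Q: "Q \<in> ?L"
    hence pQ: "partition_on (insert a A) Q" and cQ: "card Q = Suc k" by (auto simp: S_def)
    have fQ: "finite Q" using cQ by (intro card_ge_0_finite) simp
    obtain C where C: "C \<in> Q" "a \<in> C"
      using partition_onD1[OF pQ] by blast
    have dj: "disjnt C (\<Union>(Q - {C}))"
      using partition_onD2[OF pQ] C unfolding pairwise_def disjnt_def by blast
    have "partition_on (insert a A) (insert C (Q - {C}))"
      using pQ C by (simp add: insert_absorb)
    hence rest: "partition_on (insert a A - C) (Q - {C})" and CA: "C \<subseteq> insert a A"
      using partition_on_insert[OF dj] by auto
    show "Q \<in> ?R"
    proof (cases "C = {a}")
      case True
      have "Q - {C} \<in> S A k"
        using rest True a cQ fQ C by (auto simp: S_def)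
      moreover have "Q = ?f (Q - {C})" using True C by auto
      ultimately show ?thesis by blast
    next
      case False
      define B where "B = C - {a}"
      have CB: "C = insert a B" "a \<notin> B" "B \<noteq> {}" "B \<subseteq> A"
        using C False CA by (auto simp: B_def)
      have dB: "disjnt B (\<Union>(Q - {C}))" using dj by (auto simp: B_def disjnt_def)
      have "insert a A - C = A - B" using a CB by auto
      hence "partition_on A (insert B (Q - {C}))"
        using partition_on_insert[OF dB] rest CB by simp
      moreover have nin: "B \<notin> Q - {C}"
        using dB CB by (auto simp: disjnt_def)
      moreover from this have "card (insert B (Q - {C})) = Suc k"
        using cQ fQ C by (simp add: card.remove[symmetric])
      ultimately have "(insert B (Q - {C}), B) \<in> ?T" by (auto simp: S_def)
      moreover have "Q = ?g (insert B (Q - {C}), B)"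
        using nin CB C by auto
      ultimately show ?thesis by blast
    qed
  next
    fix Q assume "Q \<in> ?R"
    then consider P where "P \<in> S A k" "Q = ?f P"
      | P B where "P \<in> S A (Suc k)" "B \<in> P" "Q = ?g (P, B)" by auto
    thus "Q \<in> ?L"
    proof cases
      case 1
      have u: "\<Union>P = A" using 1 by (auto simp: S_def partition_on_def)
      have "disjnt {a} (\<Union>P)" using u a by (simp add: disjnt_def)
      hence "partition_on (insert a A) Q"
        using partition_on_insert[of "{a}" P "insert a A"] 1 a by (auto simp: S_def)
      moreover have "{a} \<notin> P" using u a by blast
      hence "card Q = Suc k" using 1 finP[OF 1(1)] by (auto simp: S_def)
      ultimately show ?thesis by (simp add: S_def)
    next
      case 2
      have pP: "partition_on A P" and cP: "card P = Suc k" using 2 by (auto simp: S_def)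
      have u: "\<Union>P = A" using pP by (auto simp: partition_on_def)
      have dB: "disjnt B (\<Union>(P - {B}))"
        using partition_onD2[OF pP] 2 unfolding pairwise_def disjnt_def by blast
      have "partition_on A (insert B (P - {B}))"
        using pP 2 by (simp add: insert_absorb)
      hence r: "partition_on (A - B) (P - {B})" "B \<subseteq> A"
        using partition_on_insert[OF dB] by auto
      have dC: "disjnt (insert a B) (\<Union>(P - {B}))"
        using dB u a by (auto simp: disjnt_def)
      have "insert a A - insert a B = A - B" using a by auto
      hence "partition_on (insert a A) Q"
        using partition_on_insert[OF dC] r 2 by auto
      moreover have "insert a B \<notin> P - {B}" using u a by blast
      hence "card Q = Suc k"
        using 2 cP finP[OF 2(1)] by (simp add: card.remove[symmetric])
      ultimately show ?thesis by (simp add: S_def)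
    qed
  qed
  have disj: "?f ` S A k \<inter> ?g ` ?T = {}"
  proof -
    have False if "P \<in> S A k" "P' \<in> S A (Suc k)" "B \<in> P'" "?f P = ?g (P', B)" for P P' B
    proof -
      have "{a} \<in> insert (insert a B) (P' - {B})" using that by auto
      moreover have "{a} \<notin> P'" using sub[OF that(2), of "{a}"] a by auto
      moreover have "B \<noteq> {}" using that by (auto simp: S_def partition_on_def)
      moreover have "a \<notin> B" using sub[OF that(2,3)] a by auto
      ultimately show False by auto
    qed
    note no = this
    show ?thesis
    proof (rule equals0I, elim IntE imageE SigmaE)
      fix Q P x P' B
      assume "Q = insert {a} P" "P \<in> S A k" "Q = ?g x" "P' \<in> S A (Suc k)" "B \<in> P'" "x = (P', B)"
      thus False using no[of P P' B] by simp
    qed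
  qed
  have injf: "inj_on ?f (S A k)"
  proof (rule inj_on_inverseI)
    fix P assume "P \<in> S A k"
    hence "{a} \<notin> P" using sub a by blast
    thus "insert {a} P - {{a}} = P" by simp
  qed
  have injg: "inj_on ?g ?T"
  proof (rule inj_onI, clarify)
    fix P B P' B'
    assume h: "P \<in> S A (Suc k)" "B \<in> P" "P' \<in> S A (Suc k)" "B' \<in> P'"
      and e: "insert (insert a B) (P - {B}) = insert (insert a B') (P' - {B'})"
    have n: "\<And>C. C \<in> P \<Longrightarrow> a \<notin> C" "\<And>C. C \<in> P' \<Longrightarrow> a \<notin> C"
      using sub[OF h(1)] sub[OF h(3)] a by blast+
    have "insert a B \<in> insert (insert a B') (P' - {B'})" using e by blast
    moreover have "insert a B \<notin> P" "insert a B \<notin> P'"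
      using n(1)[of "insert a B"] n(2)[of "insert a B"] by auto
    ultimately have nin: "insert a B \<notin> P" "insert a B \<notin> P'" and "insert a B = insert a B'"
      by simp_all
    hence BB: "B = B'" using insert_ident[OF n(1)[OF h(2)] n(2)[OF h(4)]] by simp
    have "insert (insert a B) (P - {B}) = insert (insert a B) (P' - {B})" using e BB by simp
    hence "P - {B} = P' - {B}" using nin by (subst (asm) insert_ident) simp_all
    hence "insert B (P - {B}) = insert B (P' - {B})" by simp
    hence "P = P'" using h BB by (simp add: insert_absorb)
    thus "P = P' \<and> B = B'" using BB by simp
  qed
  have "card ?T = (\<Sum>P\<in>S A (Suc k). card P)"
    using fin finP by (subst card_SigmaI) auto
  also have "\<dots> = (\<Sum>P\<in>S A (Suc k). Suc k)" by (rule sum.cong) (auto simp: S_def)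
  finally have cT: "card ?T = Suc k * card (S A (Suc k))" by simp
  have finT: "finite ?T" using fin finP by (intro finite_SigmaI) auto
  show ?thesis
    unfolding eq using disj fin finT
    by (subst card_Un_disjoint) (simp_all only: finite_imageI card_image[OF injf] card_image[OF injg] cT add.commute)
qed

lemma card_partitions_eq_Stirling:
  assumes "finite A"
  shows "card {P. partition_on A P \<and> card P = m} = Stirling (card A) m"
  using assms
proof (induction A arbitrary: m)
  case empty
  have "{P::'a set set. partition_on {} P \<and> card P = m} = (if m = 0 then {{}} else {})"
    by (auto simp: partition_on_empty)
  then show ?case by (simp only:) (cases m; simp)
next
  case (insert a A)
  show ?case
  proof (cases m)
    case 0
    have "card P \<noteq> 0" if P: "partition_on (insert a A) P" for P
    proof -
      have "finite P" using finite_elements[OF _ P] insert.hyps(1) by simp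
      moreover have "P \<noteq> {}" using partition_onD1[OF P] by auto
      ultimately show ?thesis by simp
    qed
    hence "{P. partition_on (insert a A) P \<and> card P = 0} = {}" by blast
    moreover have "Stirling (card (insert a A)) 0 = 0" using insert.hyps by simp
    ultimately show ?thesis using 0 by (simp only: card.empty)
  next
    case (Suc k)
    show ?thesis
      using card_partitions_insert[OF insert.hyps, of k] insert Suc by simp
  qed
qed

definition cycles_on :: "('a \<Rightarrow> 'a) \<Rightarrow> 'a set \<Rightarrow> 'a set set" where
  "cycles_on f A = orbit f ` A"

lemma card_cycles_on_insert:
  assumes A: "finite A" and a: "a \<notin> A" and s: "\<sigma> permutes A" and b: "b \<in> insert a A"
  shows "card (cycles_on (transpose a b \<circ> \<sigma>) (insert a A)) =
           card (cycles_on \<sigma> A) + (if b = a then 1 else 0)"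
proof (cases "b = a")
  case True
  have sa: "\<sigma> a = a" using s a by (rule permutes_not_in)
  have "orbit \<sigma> a = {a}"
  proof (intro set_eqI iffI)
    fix x assume "x \<in> orbit \<sigma> a" thus "x \<in> {a}" by induction (simp_all add: sa)
  next
    fix x assume "x \<in> {a}" thus "x \<in> orbit \<sigma> a" using orbit.base[of \<sigma> a] sa by simp
  qed
  moreover have "{a} \<notin> orbit \<sigma> ` A"
  proof
    assume "{a} \<in> orbit \<sigma> ` A"
    then obtain x where "x \<in> A" "orbit \<sigma> x = {a}" by auto
    hence "\<sigma> x = a" using orbit.base[of \<sigma> x] by simp
    thus False using \<open>x \<in> A\<close> s a by (metis permutes_in_image)
  qed
  ultimately show ?thesis using True A by (simp add: cycles_on_def)
next
  case False
  let ?t = "transpose a b \<circ> \<sigma>"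
  have bA: "b \<in> A" using b False by simp
  have sA: "\<sigma> x \<in> A \<longleftrightarrow> x \<in> A" for x using s by (rule permutes_in_image)
  have sa: "\<sigma> a = a" using s a by (rule permutes_not_in)
  have ta: "?t a = b" using sa by simp
  have "?t permutes insert a A"
    using permutes_insert[of a A] s b by auto
  hence perm: "permutation ?t" using A by (auto simp: permutation_permutes)
  have oa: "orbit ?t a = orbit ?t b"
    using permutation_orbit_step[OF perm, of a] ta by simp
  have key: "orbit ?t x - {a} = orbit \<sigma> x" if x: "x \<in> A" for x
  proof (intro set_eqI iffI)
    fix z assume "z \<in> orbit ?t x - {a}"
    moreover have "(z \<noteq> a \<longrightarrow> z \<in> orbit \<sigma> x) \<and> (z = a \<longrightarrow> b \<in> orbit \<sigma> x)"
      if "z \<in> orbit ?t x" for z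
      using that
    proof induction
      case base
      show ?case using orbit.base[of \<sigma> x] sA[of x] x a by (auto simp: transpose_def)
    next
      case (step y)
      show ?case
      proof (cases "y = a")
        case True
        thus ?thesis using step ta False by auto
      next
        case ya: False
        hence "\<sigma> y \<in> orbit \<sigma> x" using step orbit.step by metis
        moreover have "\<sigma> y \<noteq> a" using ya sA[of y] a sa s by (metis permutes_not_in)
        ultimately show ?thesis by (auto simp: transpose_def)
      qed
    qed
    ultimately show "z \<in> orbit \<sigma> x" by blast
  next
    have st: "\<sigma> y \<in> orbit ?t x" if y: "y \<in> A" "?t y \<in> orbit ?t x" for y
    proof (cases "\<sigma> y = b")
      case True
      hence "?t y = a" by simp
      hence "?t a \<in> orbit ?t x" using y orbit.step by metis
      thus ?thesis using ta True by simp
    next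
      case False
      thus ?thesis using y sA[of y] a by (auto simp: transpose_def split: if_splits)
    qed
    fix z assume "z \<in> orbit \<sigma> x"
    hence "z \<in> A \<and> z \<in> orbit ?t x"
    proof induction
      case base
      show ?case using x sA[of x] st[OF x orbit.base] by blast
    next
      case (step y)
      thus ?case using sA st[of y] orbit.step[of y ?t x] by blast
    qed
    thus "z \<in> orbit ?t x - {a}" using a by auto
  qed
  have "orbit ?t ` insert a A = orbit ?t ` A" using oa bA by auto
  moreover have "orbit \<sigma> ` A = (\<lambda>C. C - {a}) ` orbit ?t ` A"
    using key by (force simp: image_image)
  moreover have "inj_on (\<lambda>C. C - {a}) (orbit ?t ` A)"
  proof (rule inj_onI, clarify)
    fix x y assume xy: "x \<in> A" "y \<in> A" "orbit ?t x - {a} = orbit ?t y - {a}"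
    have slf: "u \<in> orbit ?t u" for u using permutation_self_in_orbit[OF perm] .
    have "x \<in> orbit ?t y" "y \<in> orbit ?t x" using slf[of x] slf[of y] xy a by blast+
    thus "orbit ?t x = orbit ?t y" by (blast intro: orbit_trans)
  qed
  ultimately show ?thesis using False by (simp add: cycles_on_def card_image)
qed

lemma card_permutations_eq_stirling:
  assumes "finite A"
  shows "card {\<pi>. \<pi> permutes A \<and> card (cycles_on \<pi> A) = m} = stirling (card A) m"
  using assms
proof (induction A arbitrary: m)
  case empty
  have "{\<pi>::'a \<Rightarrow> 'a. \<pi> permutes {} \<and> card (cycles_on \<pi> {}) = m} = (if m = 0 then {id} else {})"
    by (auto simp: cycles_on_def)
  thus ?case by (cases m) auto
next
  case (insert a A)
  let ?S = "\<lambda>B k. {\<pi>. \<pi> permutes B \<and> card (cycles_on \<pi> B) = k}"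
  let ?g = "\<lambda>(b, p). transpose a b \<circ> p"
  have fin: "finite (?S A k)" for k
    using finite_permutations[OF insert.hyps(1)] by (rule rev_finite_subset) auto
  have inj: "inj_on ?g (insert a A \<times> {p. p permutes A})"
  proof (rule inj_onI, clarify)
    fix b p c q
    assume h: "p permutes A" "q permutes A" "transpose a b \<circ> p = transpose a c \<circ> q"
    have "p a = a" "q a = a" using h insert.hyps by (auto intro: permutes_not_in)
    hence bc: "b = c" using fun_cong[OF h(3), of a] by simp
    have "transpose a b \<circ> (transpose a b \<circ> p) = transpose a b \<circ> (transpose a b \<circ> q)"
      using h(3) bc by simp
    thus "b = c \<and> p = q" using bc by (simp add: o_assoc)
  qed
  show ?case
  proof (cases m)
    case 0
    have "card (cycles_on \<pi> (insert a A)) \<noteq> 0" for \<pi>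
      using insert.hyps by (simp add: cycles_on_def)
    hence "?S (insert a A) 0 = {}" by blast
    moreover have "stirling (card (insert a A)) 0 = 0" using insert.hyps by simp
    ultimately show ?thesis using 0 by (simp only: card.empty)
  next
    case (Suc k)
    have eq: "?S (insert a A) (Suc k) = ?g ` (A \<times> ?S A (Suc k) \<union> {a} \<times> ?S A k)"
      (is "?L = ?g ` ?R")
    proof (intro set_eqI iffI)
      fix \<pi> assume L: "\<pi> \<in> ?L"
      then obtain b p where bp: "\<pi> = transpose a b \<circ> p" "b \<in> insert a A" "p permutes A"
        using eqset_imp_iff[OF permutes_insert[of a A], of \<pi>] by (auto simp del: insert_iff)
      have "(b, p) \<in> ?R"
        using card_cycles_on_insert[OF insert.hyps bp(3,2)] L bp insert.hyps
        by (auto split: if_splits)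
      thus "\<pi> \<in> ?g ` ?R" using bp by (intro image_eqI[of _ _ "(b, p)"]) auto
    next
      fix \<pi> assume "\<pi> \<in> ?g ` ?R"
      then obtain b p where bp: "\<pi> = transpose a b \<circ> p" "(b, p) \<in> ?R" by auto
      hence b: "b \<in> insert a A" "p permutes A" by auto
      have "\<pi> permutes insert a A" unfolding bp(1) prod.case
        using permutes_compose[OF permutes_subset[OF b(2)] permutes_swap_id[OF _ b(1)]] by blast
      thus "\<pi> \<in> ?L"
        using card_cycles_on_insert[OF insert.hyps b(2,1)] bp insert.hyps by auto
    qed
    have "card (?g ` ?R) = card ?R"
      by (rule card_image, rule inj_on_subset[OF inj]) auto
    also have "\<dots> = card (A \<times> ?S A (Suc k)) + card ({a} \<times> ?S A k)"
      using insert.hyps fin by (intro card_Un_disjoint) auto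
    also have "\<dots> = stirling (Suc (card A)) (Suc k)"
      by (simp add: card_cartesian_product insert.IH)
    finally show ?thesis using eq Suc insert.hyps by simp
  qed
qed

definition eulerian :: "nat \<Rightarrow> nat \<Rightarrow> nat" where
  "eulerian p m =
     card {\<pi>. \<pi> permutes {1..p} \<and> card {i. 1 \<le> i \<and> i < p \<and> \<pi> i > \<pi> (i + 1)} = m}"

definition unit_vec :: "nat \<Rightarrow> nat \<Rightarrow> nat" where
  "unit_vec m = (\<lambda>i. if i = m then 1 else 0)"

definition total :: "(nat \<Rightarrow> nat) \<Rightarrow> nat" where
  "total a = (\<Sum>i | a i \<noteq> 0. a i)"

definition weight :: "(nat \<Rightarrow> nat) \<Rightarrow> nat" where
  "weight a = (\<Sum>i | a i \<noteq> 0. i * a i)"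

text \<open>
  The finiteness condition excludes vectors of infinite support, on which
  \<^const>\<open>total\<close> and \<^const>\<open>weight\<close> would be \<open>0\<close>.
\<close>

definition Lambda :: "nat \<Rightarrow> (nat \<Rightarrow> nat) set" where
  "Lambda p = {a. finite {i. a i \<noteq> 0} \<and> total a = p - 1 \<and> weight a < p}"

lemma finite_Lambda: "finite (Lambda p)"
proof (rule finite_subset)
  show "Lambda p \<subseteq> {a. \<forall>i. (i \<in> {..<p} \<longrightarrow> a i \<in> {..p}) \<and> (i \<notin> {..<p} \<longrightarrow> a i = 0)}"
  proof (intro subsetI CollectI allI conjI impI)
    fix a i
    assume a: "a \<in> Lambda p"
    hence fin: "finite {i. a i \<noteq> 0}" and t: "total a = p - 1" and w: "weight a < p"
      by (simp_all add: Lambda_def)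
    { assume "i \<in> {..<p}"
      show "a i \<in> {..p}"
      proof (cases "a i = 0")
        case False
        hence "a i \<le> total a"
          unfolding total_def using fin by (intro member_le_sum) auto
        thus ?thesis using t by simp
      qed simp }
    { assume i: "i \<notin> {..<p}"
      show "a i = 0"
      proof (rule ccontr)
        assume nz: "a i \<noteq> 0"
        hence "i * a i \<le> weight a"
          unfolding weight_def using fin by (intro member_le_sum) auto
        moreover have "i \<le> i * a i" using nz by simp
        ultimately show False using w i by (metis le_trans lessThan_iff not_le)
      qed }
  qed
  show "finite {a. \<forall>i. (i \<in> {..<p} \<longrightarrow> a i \<in> {..p}) \<and> (i \<notin> {..<p} \<longrightarrow> a i = (0::nat))}"
    by (rule finite_set_of_finite_funs) simp_all
qed

definition fD :: "'k::field_char_0 fps \<Rightarrow> 'k fps \<Rightarrow> 'k fps" where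
  "fD f h = f * fps_deriv h"

definition expansion_coeffs :: "nat \<Rightarrow> ((nat \<Rightarrow> nat) \<Rightarrow> 'k::field_char_0) \<Rightarrow> bool" where
  "expansion_coeffs p g \<longleftrightarrow>
     (\<forall>f h. (fD f ^^ p) h =
        (\<Sum>a\<in>Lambda p. fps_const (g a) *
           (f * (\<Prod>i | a i \<noteq> 0. fps_nth_deriv i f ^ a i) * fps_nth_deriv (p - weight a) h)))"

text \<open>
  The coefficients are indexed by \<^term>\<open>Lambda p\<close> only; setting them to \<open>0\<close> elsewhere
  makes the description unique as a total function.
\<close>

definition gamma :: "nat \<Rightarrow> (nat \<Rightarrow> nat) \<Rightarrow> 'k::field_char_0" where
  "gamma p = (THE g. expansion_coeffs p g \<and> (\<forall>a. a \<notin> Lambda p \<longrightarrow> g a = 0))"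

end

theory Submission
  imports Defs "HOL-Combinatorics.Multiset_Permutations" "HOL-Computational_Algebra.Polynomial"
begin


text \<open>When \<open>fD\<close> is applied to f * P * D^k h, the product rule picks one factor to
  differentiate: D^k h, the leading f, or a factor of the product P. A history records these
  choices. The former leading f enters the list as a new 0 before the choice is made, and the f of
  the outermost application stays outside the list, since nothing has differentiated it yet.
  Different choices can produce the same list, so histories are counted as entries of a list and not
  as elements of a set. Each coefficient is the number of histories with the given multiplicities.
  The four identities then hold because the recurrence of the histories, read through a statistic
  (sum, number of zeros, all entries at most 1), is the recurrence of the numbers on the right-hand
  side. The obstacle is that \<open>gamma\<close> is a definite description: the count is its value
  only once the identity is known to determine the coefficients, over every field of characteristic
  0.\<close>

fun increments :: "nat list \<Rightarrow> nat list list" where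
  "increments [] = []"
| "increments (x # xs) = (Suc x # xs) # map ((#) x) (increments xs)"

text \<open>
  The derivative orders of the factors \<open>f\<^sub>2, \<dots>, f\<^bsub>n+1\<^esub>\<close> in the expansion of \<open>(fD)\<^bsup>n+1\<^esup>\<close>, listed with
  multiplicity; note the shift, \<open>n = p - 1\<close>.
\<close>

fun histories :: "nat \<Rightarrow> nat list list" where
  "histories 0 = [[]]"
| "histories (Suc n) = concat (map (\<lambda>xs. (0 # xs) # increments (0 # xs)) (histories n))"

lemma sum_list_concat_map:
  "sum_list (map g (concat (map k xs))) = (\<Sum>x\<leftarrow>xs. sum_list (map g (k x)))"
  by (induction xs) simp_all

lemma sum_histories_Suc:
  "(\<Sum>ys\<leftarrow>histories (Suc n). \<phi> ys) =
     (\<Sum>xs\<leftarrow>histories n. \<phi> (0 # xs) + (\<Sum>ys\<leftarrow>increments (0 # xs). \<phi> ys))"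
  by (simp only: histories.simps sum_list_concat_map list.map sum_list.Cons)

lemma increments_length_sum:
  "ys \<in> set (increments xs) \<Longrightarrow> length ys = length xs \<and> sum_list ys = Suc (sum_list xs)"
  by (induction xs arbitrary: ys) auto

lemma histories_length_sum:
  "xs \<in> set (histories n) \<Longrightarrow> length xs = n \<and> sum_list xs \<le> n"
proof (induction n arbitrary: xs)
  case (Suc n)
  then obtain ys where ys: "ys \<in> set (histories n)" "xs = 0 # ys \<or> xs \<in> set (increments (0 # ys))"
    by auto
  thus ?case using Suc.IH[OF ys(1)] increments_length_sum[of xs "0 # ys"] by fastforce
qed simp

section \<open>The product rule and the powers of \<open>fD\<close>\<close>

lemma fps_deriv_prod_list:
  "fps_deriv (\<Prod>x\<leftarrow>xs. fps_nth_deriv x f) = (\<Sum>ys\<leftarrow>increments xs. \<Prod>y\<leftarrow>ys. fps_nth_deriv y f)"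
proof (induction xs)
  case (Cons x xs)
  have "(\<Sum>ys\<leftarrow>map ((#) x) (increments xs). \<Prod>y\<leftarrow>ys. fps_nth_deriv y f) =
      fps_nth_deriv x f * (\<Sum>ys\<leftarrow>increments xs. \<Prod>y\<leftarrow>ys. fps_nth_deriv y f)"
    by (simp add: sum_list_const_mult o_def)
  thus ?case using Cons by (simp add: fps_nth_deriv_commute[symmetric] algebra_simps)
qed simp

text \<open>There are p derivatives to distribute. Those that do not land on a factor of the list
  land on \<open>h\<close>, whence the order \<open>p - sum_list xs\<close>.\<close>

definition history_term :: "nat \<Rightarrow> 'k::field_char_0 fps \<Rightarrow> 'k fps \<Rightarrow> nat list \<Rightarrow> 'k fps" where
  "history_term p f h xs = f * (\<Prod>x\<leftarrow>xs. fps_nth_deriv x f) * fps_nth_deriv (p - sum_list xs) h"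

lemma fD_sum_list: "fD f (\<Sum>x\<leftarrow>xs. g x) = (\<Sum>x\<leftarrow>xs. fD f (g x))"
  by (induction xs) (simp_all add: fD_def algebra_simps)

text \<open>The derivative hits either D^k h or one entry of \<open>0 # xs\<close>, where the 0
  stands for the former leading f. In the first case the order of D grows; in the second
  \<open>sum_list\<close> grows with the total, and the order stays k.\<close>

lemma fD_history_term:
  assumes "length xs = n" "sum_list xs \<le> n"
  shows "fD f (history_term (Suc n) f h xs) =
    history_term (Suc (Suc n)) f h (0 # xs) +
    (\<Sum>ys\<leftarrow>increments (0 # xs). history_term (Suc (Suc n)) f h ys)"
proof -
  let ?P = "\<lambda>xs. \<Prod>x\<leftarrow>xs. fps_nth_deriv x f" and ?k = "Suc n - sum_list xs"
  have "history_term (Suc (Suc n)) f h ys = f * fps_nth_deriv ?k h * ?P ys"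
    if "ys \<in> set (increments (0 # xs))" for ys
    using increments_length_sum[OF that] by (simp add: history_term_def ac_simps)
  hence "(\<Sum>ys\<leftarrow>increments (0 # xs). history_term (Suc (Suc n)) f h ys) =
      (\<Sum>ys\<leftarrow>increments (0 # xs). f * fps_nth_deriv ?k h * ?P ys)"
    by (intro arg_cong[of _ _ sum_list] map_cong) auto
  also have "\<dots> = f * fps_nth_deriv ?k h * fps_deriv (?P (0 # xs))"
    by (simp only: sum_list_const_mult fps_deriv_prod_list)
  finally have 1: "(\<Sum>ys\<leftarrow>increments (0 # xs). history_term (Suc (Suc n)) f h ys) =
    f * fps_nth_deriv ?k h * fps_deriv (?P (0 # xs))" .
  \<comment> \<open>The bound on \<open>sum_list xs\<close> keeps the subtraction from truncating,
    so \<open>h\<close> really gains a derivative.\<close>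
  have 2: "Suc (Suc n) - sum_list xs = Suc ?k" using assms by simp
  have 3: "history_term (Suc n) f h xs = ?P (0 # xs) * fps_nth_deriv ?k h"
    by (simp add: history_term_def)
  have 4: "history_term (Suc (Suc n)) f h (0 # xs) = f * ?P (0 # xs) * fps_deriv (fps_nth_deriv ?k h)"
    by (simp add: history_term_def 2 fps_nth_deriv_commute[symmetric] mult.assoc)
  show ?thesis
    unfolding 1 3 4 fD_def fps_deriv_mult by (simp only: algebra_simps)
qed

lemma fD_power_histories:
  "(fD f ^^ Suc n) h = (\<Sum>xs\<leftarrow>histories n. history_term (Suc n) f h xs)"
proof (induction n)
  case 0
  show ?case by (simp add: history_term_def fD_def)
next
  case (Suc n)
  have "(fD f ^^ Suc (Suc n)) h = (\<Sum>xs\<leftarrow>histories n. fD f (history_term (Suc n) f h xs))"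
    unfolding funpow.simps(2)[of "Suc n"] o_apply Suc.IH fD_sum_list ..
  also have "\<dots> = (\<Sum>xs\<leftarrow>histories (Suc n). history_term (Suc (Suc n)) f h xs)"
    unfolding sum_histories_Suc
  proof (intro arg_cong[of _ _ sum_list] map_cong refl)
    fix xs assume "xs \<in> set (histories n)"
    thus "fD f (history_term (Suc n) f h xs) = history_term (Suc (Suc n)) f h (0 # xs) +
        (\<Sum>ys\<leftarrow>increments (0 # xs). history_term (Suc (Suc n)) f h ys)"
      using histories_length_sum by (intro fD_history_term) auto
  qed
  finally show ?case .
qed

section \<open>From histories to exponent vectors\<close>

lemma support_count_list: "{i. count_list xs i \<noteq> 0} = set xs"
  by (auto simp: count_list_0_iff)

lemma total_count_list: "total (count_list xs) = length xs"
  unfolding total_def support_count_list by (rule sum_count_set) simp_all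

lemma weight_count_list: "weight (count_list xs) = sum_list xs"
  unfolding weight_def support_count_list
  using sum_list_map_eq_sum_count[of "\<lambda>x. x" xs] by (simp add: mult.commute)

lemma prod_count_list:
  fixes g :: "'a \<Rightarrow> 'b::comm_monoid_mult"
  shows "(\<Prod>i\<in>set xs. g i ^ count_list xs i) = (\<Prod>x\<leftarrow>xs. g x)"
proof -
  have "(\<Prod>x\<leftarrow>xs. g x) = prod_mset (image_mset g (mset xs))"
    by (simp flip: prod_mset_prod_list)
  also have "\<dots> = (\<Prod>i\<in>set xs. g i ^ count_list xs i)"
    by (subst image_prod_mset_multiplicity) (simp add: count_mset)
  finally show ?thesis ..
qed

lemma count_list_histories_in_Lambda:
  "xs \<in> set (histories n) \<Longrightarrow> count_list xs \<in> Lambda (Suc n)"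
  using histories_length_sum[of xs n]
  unfolding Lambda_def mem_Collect_eq support_count_list total_count_list weight_count_list by simp

text \<open>Sorts the entries of a list by the key \<open>\<kappa>\<close>; in this way a sum over
  histories becomes a sum over \<open>Lambda\<close>.\<close>

lemma sum_group_list:
  fixes \<phi> :: "'b \<Rightarrow> 'k::comm_semiring_1"
  assumes "finite A" "\<And>x. x \<in> set xs \<Longrightarrow> \<kappa> x \<in> A"
  shows "(\<Sum>a\<in>A. of_nat (\<Sum>x\<leftarrow>xs. of_bool (\<kappa> x = a)) * \<phi> a) = (\<Sum>x\<leftarrow>xs. \<phi> (\<kappa> x))"
  using assms(2)
proof (induction xs)
  case (Cons x xs)
  have "(\<Sum>a\<in>A. of_bool (\<kappa> x = a) * \<phi> a) = (\<Sum>a\<in>A. if \<kappa> x = a then \<phi> a else 0)"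
    by (intro sum.cong) auto
  also have "\<dots> = \<phi> (\<kappa> x)" using assms(1) Cons.prems by simp
  finally show ?case using Cons by (simp add: ring_distribs sum.distrib)
qed simp

text \<open>Repeated lists count repeatedly: for n = 2 the list [0, 1] is reached by two sequences
  of choices.\<close>

definition history_count :: "nat \<Rightarrow> (nat \<Rightarrow> nat) \<Rightarrow> nat" where
  "history_count n a = (\<Sum>xs\<leftarrow>histories n. of_bool (count_list xs = a))"

lemma of_nat_sum_list:
  "(of_nat (\<Sum>x\<leftarrow>xs. g x) :: 'k::semiring_1) = (\<Sum>x\<leftarrow>xs. of_nat (g x))"
  by (induction xs) simp_all

lemma expansion_coeffs_history_count:
  "expansion_coeffs (Suc n) (\<lambda>a. of_nat (history_count n a))"
  unfolding expansion_coeffs_def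
proof (intro allI)
  fix f h :: "'a fps"
  let ?t = "\<lambda>a. f * (\<Prod>i | a i \<noteq> 0. fps_nth_deriv i f ^ a i) * fps_nth_deriv (Suc n - weight a) h"
  have "(\<Sum>a\<in>Lambda (Suc n). fps_const (of_nat (history_count n a)) * ?t a) =
      (\<Sum>xs\<leftarrow>histories n. ?t (count_list xs))"
    unfolding history_count_def fps_of_nat
    by (rule sum_group_list[OF finite_Lambda count_list_histories_in_Lambda])
  also have "\<dots> = (\<Sum>xs\<leftarrow>histories n. history_term (Suc n) f h xs)"
    by (simp only: support_count_list weight_count_list prod_count_list history_term_def)
  finally show "(fD f ^^ Suc n) h = (\<Sum>a\<in>Lambda (Suc n). fps_const (of_nat (history_count n a)) * ?t a)"
    by (simp only: fD_power_histories)
qed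

section \<open>Uniqueness of the coefficients\<close>

lemma digit_expansion_unique:
  fixes a b :: "nat \<Rightarrow> nat"
  assumes "\<And>i. i < n \<Longrightarrow> a i < B" "\<And>i. i < n \<Longrightarrow> b i < B"
    and "(\<Sum>i<n. a i * B ^ i) = (\<Sum>i<n. b i * B ^ i)" "i < n"
  shows "a i = b i"
  using assms
proof (induction n arbitrary: a b i)
  case (Suc n)
  have split: "(\<Sum>i<Suc n. c i * B ^ i) = c 0 + B * (\<Sum>i<n. c (Suc i) * B ^ i)" for c
    unfolding sum.lessThan_Suc_shift by (simp add: sum_distrib_left ac_simps)
  have eq: "a 0 + B * (\<Sum>i<n. a (Suc i) * B ^ i) = b 0 + B * (\<Sum>i<n. b (Suc i) * B ^ i)"
    using Suc.prems(3) by (simp only: split)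
  have lt: "a 0 < B" "b 0 < B" using Suc.prems(1,2) by auto
  have 0: "a 0 = b 0" using arg_cong[OF eq, of "\<lambda>x. x mod B"] lt by simp
  hence rest: "(\<Sum>i<n. a (Suc i) * B ^ i) = (\<Sum>i<n. b (Suc i) * B ^ i)"
    using eq lt by auto
  show ?case
  proof (cases i)
    case (Suc j)
    thus ?thesis using Suc.IH[OF _ _ rest, of j] Suc.prems by auto
  qed (use 0 in simp)
qed simp

text \<open>The two bounds make a vector of \<open>Lambda p\<close> the digit sequence of a number
  with p digits in base \<open>Suc p\<close>.\<close>

lemma Lambda_bounds:
  assumes "a \<in> Lambda p"
  shows "a i < Suc p" and "\<not> i < p \<Longrightarrow> a i = 0"
proof -
  have fin: "finite {i. a i \<noteq> 0}" and t: "total a = p - 1" and w: "weight a < p"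
    using assms by (simp_all add: Lambda_def)
  show "a i < Suc p"
  proof (cases "a i = 0")
    case False
    hence "a i \<le> total a"
      unfolding total_def using fin by (intro member_le_sum) auto
    thus ?thesis using t by simp
  qed simp
  assume i: "\<not> i < p"
  show "a i = 0"
  proof (rule ccontr)
    assume nz: "a i \<noteq> 0"
    hence "i * a i \<le> weight a"
      unfolding weight_def using fin by (intro member_le_sum) auto
    moreover have "i \<le> i * a i" using nz by simp
    ultimately show False using w i by linarith
  qed
qed

text \<open>
  Kronecker substitution: for \<open>c\<^sub>i = y\<^bsup>B^i\<^esup>\<close> with \<open>B\<close> larger than all exponents, distinct monomials become
  distinct powers of \<open>y\<close>. The factor \<open>c 0\<close> is the leading \<open>f\<close> of the operator identity.
\<close>

lemma Lambda_polynomial_coeff_eq_0: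
  fixes d :: "(nat \<Rightarrow> nat) \<Rightarrow> 'k::field_char_0"
  assumes vanish: "\<And>c :: nat \<Rightarrow> 'k. c 0 * (\<Sum>a\<in>Lambda p. d a * (\<Prod>i | a i \<noteq> 0. c i ^ a i)) = 0"
    and a: "a \<in> Lambda p"
  shows "d a = 0"
proof -
  define E where "E a = (\<Sum>i<p. a i * Suc p ^ i)" for a :: "nat \<Rightarrow> nat"
  have inj: "inj_on E (Lambda p)"
  proof (intro inj_onI ext)
    fix a b i assume ab: "a \<in> Lambda p" "b \<in> Lambda p" "E a = E b"
    show "a i = b i"
    proof (cases "i < p")
      case True
      show ?thesis
        by (rule digit_expansion_unique[OF _ _ ab(3)[unfolded E_def] True])
          (use Lambda_bounds(1) ab in blast)+
    qed (use Lambda_bounds(2) ab in metis)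
  qed
  \<comment> \<open>The \<open>Suc\<close> accounts for the factor c 0, which becomes y^(B^0) =
    y.\<close>
  define q where "q = (\<Sum>a\<in>Lambda p. monom (d a) (Suc (E a)))"
  have "poly q y = 0" for y
  proof -
    have "(\<Prod>i | a i \<noteq> 0. (y ^ (Suc p ^ i)) ^ a i) = y ^ E a" if "a \<in> Lambda p" for a
    proof -
      have "(\<Prod>i | a i \<noteq> 0. (y ^ (Suc p ^ i)) ^ a i) = (\<Prod>i<p. (y ^ (Suc p ^ i)) ^ a i)"
        by (rule prod.mono_neutral_left) (use Lambda_bounds(2)[OF that] in \<open>auto intro: ccontr\<close>)
      thus ?thesis by (simp add: E_def power_sum mult.commute flip: power_mult)
    qed
    thus ?thesis using vanish[of "\<lambda>i. y ^ (Suc p ^ i)"]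
      by (simp add: q_def poly_sum poly_monom sum_distrib_left ac_simps)
  qed
  \<comment> \<open>A field of characteristic 0 is infinite, so a polynomial vanishing at every
    point is zero.\<close>
  hence "q = 0" by (simp add: poly_all_0_iff_0[symmetric])
  moreover have "coeff q (Suc (E a)) = (\<Sum>b\<in>Lambda p. if E b = E a then d b else 0)"
    by (simp add: q_def coeff_sum)
  ultimately have "(\<Sum>b\<in>Lambda p. if E b = E a then d b else 0) = 0" by simp
  moreover have "(\<Sum>b\<in>Lambda p. if E b = E a then d b else 0) = (\<Sum>b\<in>Lambda p. if b = a then d b else 0)"
    by (intro sum.cong refl) (use inj a in \<open>auto dest: inj_onD\<close>)
  ultimately show ?thesis using a finite_Lambda by simp
qed

lemma fps_prod_nth_0:
  "fps_nth (\<Prod>i\<in>I. f i) 0 = (\<Prod>i\<in>I. fps_nth (f i :: 'k::comm_ring_1 fps) 0)"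
  by (induction I rule: infinite_finite_induct) simp_all

text \<open>
  Substituting a power series with prescribed Taylor coefficients for \<open>f\<close> and \<open>exp\<close> for \<open>h\<close>
  turns the operator identity at \<open>0\<close> into a polynomial identity in these coefficients.
\<close>

lemma expansion_coeffs_unique:
  fixes g g' :: "(nat \<Rightarrow> nat) \<Rightarrow> 'k::field_char_0"
  assumes "expansion_coeffs p g" "expansion_coeffs p g'" and a: "a \<in> Lambda p"
  shows "g a = g' a"
proof -
  define d where "d a = g a - g' a" for a
  have vanish: "c 0 * (\<Sum>a\<in>Lambda p. d a * (\<Prod>i | a i \<noteq> 0. c i ^ a i)) = 0" for c :: "nat \<Rightarrow> 'k"
  proof -
    define f where "f = Abs_fps (\<lambda>i. c i / fact i)"
    \<comment> \<open>All derivatives of exp have constant term 1, so the order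
      \<open>p - weight a\<close> leaves no trace at 0; the vectors are still told apart by their
      monomials in c.\<close>
    define t where "t a = f * (\<Prod>i | a i \<noteq> 0. fps_nth_deriv i f ^ a i) *
      fps_nth_deriv (p - weight a) (fps_exp 1)" for a :: "nat \<Rightarrow> nat"
    have c: "fps_nth (fps_nth_deriv i f) 0 = c i" for i
      by (simp add: fps_deriv_maclauren_0 f_def)
    have "(\<Sum>a\<in>Lambda p. fps_const (g a) * t a) = (\<Sum>a\<in>Lambda p. fps_const (g' a) * t a)"
      using assms(1,2) unfolding expansion_coeffs_def t_def by metis
    from arg_cong[OF this, of "\<lambda>F. fps_nth F 0"]
    have "(\<Sum>a\<in>Lambda p. g a * fps_nth (t a) 0) = (\<Sum>a\<in>Lambda p. g' a * fps_nth (t a) 0)"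
      by (simp add: fps_sum_nth)
    moreover have "fps_nth (t a) 0 = c 0 * (\<Prod>i | a i \<noteq> 0. c i ^ a i)" for a
      using c[of 0] by (simp add: t_def fps_prod_nth_0 fps_nth_power_0 c)
    ultimately show ?thesis
      by (simp add: d_def left_diff_distrib sum_subtractf ac_simps flip: sum_distrib_left)
  qed
  show ?thesis
    using Lambda_polynomial_coeff_eq_0[of d p, OF vanish a] by (simp add: d_def)
qed

section \<open>The coefficients as numbers of histories\<close>

text \<open>The counts satisfy the operator identity, and they vanish off \<open>Lambda\<close>
  because the vector of every history lies in it. Uniqueness on \<open>Lambda\<close> then evaluates
  the definite description.\<close>

lemma gamma_eq_history_count:
  "gamma (Suc n) a = (of_nat (history_count n a) :: 'k::field_char_0)"
proof -
  let ?g = "\<lambda>a. of_nat (history_count n a) :: 'k"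
  have 0: "history_count n a = 0" if "a \<notin> Lambda (Suc n)" for a
    unfolding history_count_def using that count_list_histories_in_Lambda
    by (force simp: sum_list_eq_0_iff)
  have "gamma (Suc n) = ?g"
    unfolding gamma_def
  proof (rule the_equality)
    show "expansion_coeffs (Suc n) ?g \<and> (\<forall>a. a \<notin> Lambda (Suc n) \<longrightarrow> ?g a = 0)"
      using expansion_coeffs_history_count 0 by simp
    fix g :: "(nat \<Rightarrow> nat) \<Rightarrow> 'k"
    assume g: "expansion_coeffs (Suc n) g \<and> (\<forall>a. a \<notin> Lambda (Suc n) \<longrightarrow> g a = 0)"
    show "g = ?g"
    proof
      fix a show "g a = ?g a"
        using expansion_coeffs_unique[OF conjunct1[OF g] expansion_coeffs_history_count[of n], of a]
          g 0[of a]
        by (cases "a \<in> Lambda (Suc n)") auto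
    qed
  qed
  thus ?thesis by simp
qed

lemma sum_gamma:
  "(\<Sum>a | a \<in> Lambda (Suc n) \<and> P a. gamma (Suc n) a :: 'k::field_char_0) =
     of_nat (\<Sum>xs\<leftarrow>histories n. of_bool (P (count_list xs)))"
proof -
  have "(\<Sum>a | a \<in> Lambda (Suc n) \<and> P a. gamma (Suc n) a :: 'k) =
      (\<Sum>a\<in>Lambda (Suc n). of_nat (history_count n a) * of_bool (P a))"
    using finite_Lambda by (intro sum.mono_neutral_cong_left) (auto simp: gamma_eq_history_count)
  also have "\<dots> = (\<Sum>xs\<leftarrow>histories n. of_bool (P (count_list xs)))"
    unfolding history_count_def
    by (rule sum_group_list[OF finite_Lambda count_list_histories_in_Lambda])
  finally show ?thesis by (simp add: of_nat_sum_list)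
qed


section \<open>Counting histories by zeros, by sum, and by entries at most 1\<close>

text \<open>Raising a zero loses one zero, raising any other entry loses none; the sum grows by one
  either way. Without zeros, the truncated \<open>count_list xs 0 - 1\<close> is multiplied by
  0.\<close>

lemma sum_increments_zeros:
  fixes \<phi> :: "nat \<Rightarrow> nat \<Rightarrow> nat"
  shows "(\<Sum>ys\<leftarrow>increments xs. \<phi> (count_list ys 0) (sum_list ys)) =
    count_list xs 0 * \<phi> (count_list xs 0 - 1) (Suc (sum_list xs)) +
    (length xs - count_list xs 0) * \<phi> (count_list xs 0) (Suc (sum_list xs))"
proof (induction xs arbitrary: \<phi>)
  case (Cons x xs)
  obtain r where r: "length xs = count_list xs 0 + r"
    using count_le_length[of xs 0] le_Suc_ex by blast
  show ?case
    using Cons.IH[of "\<lambda>z s. \<phi> (z + of_bool (x = 0)) (x + s)"] r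
    by (cases "count_list xs 0") (auto simp: o_def algebra_simps)
qed simp

text \<open>The pair (number of zeros, sum) evolves without further knowledge of the list. If xs has
  z zeros, \<open>0 # xs\<close> has z + 1 zeros and n - z other entries; the three terms correspond
  to raising nothing, a zero, or another entry.\<close>

lemma sum_histories_zeros:
  fixes \<phi> :: "nat \<Rightarrow> nat \<Rightarrow> nat"
  shows "(\<Sum>ys\<leftarrow>histories (Suc n). \<phi> (count_list ys 0) (sum_list ys)) =
    (\<Sum>xs\<leftarrow>histories n. \<phi> (Suc (count_list xs 0)) (sum_list xs)
       + Suc (count_list xs 0) * \<phi> (count_list xs 0) (Suc (sum_list xs))
       + (n - count_list xs 0) * \<phi> (Suc (count_list xs 0)) (Suc (sum_list xs)))"
  unfolding sum_histories_Suc
proof (intro arg_cong[of _ _ sum_list] map_cong refl)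
  fix xs assume "xs \<in> set (histories n)"
  hence "length xs = n" using histories_length_sum by blast
  thus "\<phi> (count_list (0 # xs) 0) (sum_list (0 # xs)) +
      (\<Sum>ys\<leftarrow>increments (0 # xs). \<phi> (count_list ys 0) (sum_list ys)) =
      \<phi> (Suc (count_list xs 0)) (sum_list xs)
       + Suc (count_list xs 0) * \<phi> (count_list xs 0) (Suc (sum_list xs))
       + (n - count_list xs 0) * \<phi> (Suc (count_list xs 0)) (Suc (sum_list xs))"
    unfolding sum_increments_zeros by simp
qed

lemma sum_list_zeroI:
  fixes g :: "'a \<Rightarrow> nat"
  shows "(\<And>x. x \<in> set xs \<Longrightarrow> g x = 0) \<Longrightarrow> (\<Sum>x\<leftarrow>xs. g x) = 0"
  by (induction xs) simp_all

text \<open>In the step to \<open>Suc n\<close> the sum stays in one way and grows in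
  \<open>Suc n\<close> ways, one for each entry of \<open>0 # xs\<close>: the recurrence of
  \<open>stirling\<close>. The additive form of the condition avoids truncation, and at m = 0 both
  sides are 0 since the sum never exceeds n.\<close>

lemma histories_by_sum:
  "(\<Sum>xs\<leftarrow>histories n. of_bool (sum_list xs + m = Suc n)) = stirling (Suc n) m"
proof (induction n arbitrary: m)
  case 0
  show ?case by (cases m) auto
next
  case (Suc n)
  show ?case
  proof (cases m)
    case 0
    have "sum_list xs + m \<noteq> Suc (Suc n)" if "xs \<in> set (histories (Suc n))" for xs
      using histories_length_sum[OF that] 0 by simp
    hence "(\<Sum>xs\<leftarrow>histories (Suc n). of_bool (sum_list xs + m = Suc (Suc n)) :: nat) = 0"
      by (intro sum_list_zeroI) simp
    thus ?thesis using 0 by (simp only: stirling.simps)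
  next
    case (Suc k)
    let ?s = "\<lambda>m xs. of_bool (sum_list xs + m = Suc n) :: nat"
    have "(\<Sum>xs\<leftarrow>histories (Suc n). of_bool (sum_list xs + m = Suc (Suc n))) =
        (\<Sum>xs\<leftarrow>histories n. ?s k xs + Suc n * ?s (Suc k) xs)"
      unfolding sum_histories_zeros[of "\<lambda>z s. of_bool (s + m = Suc (Suc n))"]
    proof (intro arg_cong[of _ _ sum_list] map_cong refl)
      fix xs assume "xs \<in> set (histories n)"
      then have "count_list xs 0 \<le> n" using histories_length_sum count_le_length by metis
      thus "of_bool (sum_list xs + m = Suc (Suc n)) +
          Suc (count_list xs 0) * of_bool (Suc (sum_list xs) + m = Suc (Suc n)) +
          (n - count_list xs 0) * of_bool (Suc (sum_list xs) + m = Suc (Suc n)) =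
          ?s k xs + Suc n * ?s (Suc k) xs"
        using Suc by auto
    qed
    also have "\<dots> = stirling (Suc (Suc n)) m"
      using Suc.IH[of k] Suc.IH[of "Suc k"] Suc by (simp add: sum_list_addf sum_list_const_mult)
    finally show ?thesis .
  qed
qed

lemma all_zero_list:
  assumes "count_list xs 0 = length xs"
  shows "sum_list xs = 0" and "count_list xs i = length xs * unit_vec 0 i"
proof -
  have "\<forall>x\<in>set xs. x = 0"
    using assms
  proof (induction xs)
    case (Cons x xs)
    thus ?case using count_le_length[of xs 0] by (auto split: if_splits)
  qed simp
  thus "sum_list xs = 0" and "count_list xs i = length xs * unit_vec 0 i"
    using assms by (auto simp: unit_vec_def count_list_0_iff)
qed

text \<open>The only nonzero entry equals the sum, so the number of zeros and the sum determine the
  whole vector.\<close>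

lemma one_nonzero_list:
  assumes "Suc (count_list xs 0) = length xs"
  shows "sum_list xs > 0 \<and> count_list xs i = (length xs - 1) * unit_vec 0 i + unit_vec (sum_list xs) i"
  using assms
proof (induction xs)
  case (Cons x xs)
  show ?case
  proof (cases "x = 0")
    case True
    hence "length xs = Suc (count_list xs 0)" using Cons.prems by simp
    thus ?thesis using Cons.IH True by (auto simp: unit_vec_def simp del: sum_list_eq_0_iff)
  next
    case False
    thus ?thesis using Cons.prems all_zero_list[of xs] by (auto simp: unit_vec_def)
  qed
qed simp

text \<open>Pascal's rule. A single nonzero entry m = k + 1 was either left alone or raised from k.
  For k = 0 the second source is the all-zero list, where any of the \<open>Suc n\<close> entries of
  \<open>0 # xs\<close> may be raised.\<close>

lemma histories_one_nonzero:
  assumes "m > 0"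
  shows "(\<Sum>xs\<leftarrow>histories n. of_bool (Suc (count_list xs 0) = n \<and> sum_list xs = m)) = Suc n choose Suc m"
  using assms
proof (induction n arbitrary: m)
  case (Suc n)
  let ?C = "\<lambda>m xs. of_bool (Suc (count_list xs 0) = n \<and> sum_list xs = m) :: nat"
  obtain k where k: "m = Suc k" using Suc.prems by (cases m) auto
  have "(\<Sum>ys\<leftarrow>histories (Suc n). of_bool (Suc (count_list ys 0) = Suc n \<and> sum_list ys = m)) =
      (\<Sum>xs\<leftarrow>histories n. ?C m xs + (if k = 0 then Suc n * of_bool (sum_list xs + Suc n = Suc n) else ?C k xs))"
    unfolding sum_histories_zeros[of "\<lambda>z s. of_bool (Suc z = Suc n \<and> s = m)"]
  proof (intro arg_cong[of _ _ sum_list] map_cong refl)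
    fix xs assume "xs \<in> set (histories n)"
    hence l: "length xs = n" using histories_length_sum by blast
    have "count_list xs 0 = n" if "sum_list xs = 0"
    proof -
      have "\<forall>x\<in>set xs. x = 0" using that by simp
      hence "count_list xs 0 = length xs" by (induction xs) simp_all
      thus ?thesis using l by simp
    qed
    moreover have "sum_list xs = 0" if "count_list xs 0 = n"
      using all_zero_list(1) l that by blast
    moreover have "n - count_list xs 0 = 1" if "Suc (count_list xs 0) = n"
      using that by simp
    ultimately show "of_bool (Suc (Suc (count_list xs 0)) = Suc n \<and> sum_list xs = m) +
         Suc (count_list xs 0) * of_bool (Suc (count_list xs 0) = Suc n \<and> Suc (sum_list xs) = m) +
         (n - count_list xs 0) * of_bool (Suc (Suc (count_list xs 0)) = Suc n \<and> Suc (sum_list xs) = m) =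
         ?C m xs + (if k = 0 then Suc n * of_bool (sum_list xs + Suc n = Suc n) else ?C k xs)"
      unfolding k by (auto simp del: sum_list_eq_0_iff)
  qed
  also have "\<dots> = (Suc n choose Suc m) + (Suc n choose m)"
  proof (cases "k = 0")
    case True
    \<comment> \<open>The all-zero history occurs exactly once: this is the top case of the count by
      sum.\<close>
    have "(\<Sum>xs\<leftarrow>histories n. of_bool (sum_list xs + Suc n = Suc n) :: nat) = 1"
      by (simp only: histories_by_sum stirling_same)
    hence "(\<Sum>xs\<leftarrow>histories n. Suc n * of_bool (sum_list xs + Suc n = Suc n)) = Suc n"
      by (simp only: sum_list_const_mult mult_1_right)
    moreover have "Suc n choose m = Suc n" using True k by simp
    ultimately show ?thesis
      unfolding sum_list_addf Suc.IH[OF Suc.prems] by (simp only: True if_True refl)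
  next
    case False
    hence "(\<Sum>xs\<leftarrow>histories n. ?C k xs) = Suc n choose m" using Suc.IH[of k] k by simp
    thus ?thesis
      unfolding sum_list_addf Suc.IH[OF Suc.prems] by (simp only: False if_False)
  qed
  also have "\<dots> = Suc (Suc n) choose Suc m"
    by (simp only: binomial_Suc_Suc add.commute)
  finally show ?case .
qed simp

text \<open>A raised list has entries at most 1 only if the old one did and a zero was raised; such
  a list has \<open>length xs - sum_list xs\<close> zeros.\<close>

lemma sum_increments_le_1:
  fixes \<phi> :: "nat \<Rightarrow> nat"
  shows "(\<Sum>ys\<leftarrow>increments xs. of_bool (\<forall>y\<in>set ys. y \<le> 1) * \<phi> (sum_list ys)) =
    of_bool (\<forall>x\<in>set xs. x \<le> 1) * (length xs - sum_list xs) * \<phi> (Suc (sum_list xs))"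
proof (induction xs arbitrary: \<phi>)
  case (Cons x xs)
  consider "x = 0" | "x = 1" | "x \<ge> 2" by linarith
  thus ?case
  proof cases
    case 1
    have "sum_list xs \<le> length xs" if "\<forall>x\<in>set xs. x \<le> 1"
      using that by (induction xs) auto
    thus ?thesis using Cons.IH[of \<phi>] 1 by (auto simp: o_def Suc_diff_le)
  next
    case 2
    show ?thesis using Cons.IH[of "\<lambda>s. \<phi> (Suc s)"] 2 by (auto simp: o_def)
  next
    case 3
    thus ?thesis by (auto simp: o_def)
  qed
qed simp

text \<open>The factor m in the recurrence of \<open>Stirling\<close> is the number
  \<open>Suc n - sum_list xs\<close> of zeros in \<open>0 # xs\<close>: it equals m exactly when
  raising one of them leads to the required sum.\<close>

lemma histories_le_1:
  "(\<Sum>xs\<leftarrow>histories n. of_bool ((\<forall>x\<in>set xs. x \<le> 1) \<and> sum_list xs + m = Suc n)) = Stirling (Suc n) m"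
proof (induction n arbitrary: m)
  case 0
  show ?case by (cases m) auto
next
  case (Suc n)
  show ?case
  proof (cases m)
    case 0
    have "sum_list xs + m \<noteq> Suc (Suc n)" if "xs \<in> set (histories (Suc n))" for xs
      using histories_length_sum[OF that] 0 by simp
    hence "(\<Sum>xs\<leftarrow>histories (Suc n).
        of_bool ((\<forall>x\<in>set xs. x \<le> 1) \<and> sum_list xs + m = Suc (Suc n)) :: nat) = 0"
      by (intro sum_list_zeroI) simp
    thus ?thesis using 0 by (simp only: Stirling.simps)
  next
    case (Suc k)
    let ?s = "\<lambda>m xs. of_bool ((\<forall>x\<in>set xs. x \<le> 1) \<and> sum_list xs + m = Suc n) :: nat"
    have "(\<Sum>xs\<leftarrow>histories (Suc n). of_bool ((\<forall>x\<in>set xs. x \<le> 1) \<and> sum_list xs + m = Suc (Suc n))) =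
        (\<Sum>xs\<leftarrow>histories n. ?s k xs + m * ?s m xs)"
      unfolding sum_histories_Suc of_bool_conj
        sum_increments_le_1[of "\<lambda>s. of_bool (s + m = Suc (Suc n))"]
    proof (intro arg_cong[of _ _ sum_list] map_cong refl)
      fix xs assume "xs \<in> set (histories n)"
      hence "length xs = n" using histories_length_sum by blast
      thus "of_bool (\<forall>x\<in>set (0 # xs). x \<le> 1) * of_bool (sum_list (0 # xs) + m = Suc (Suc n)) +
         of_bool (\<forall>x\<in>set (0 # xs). x \<le> 1) * (length (0 # xs) - sum_list (0 # xs)) *
         of_bool (Suc (sum_list (0 # xs)) + m = Suc (Suc n)) =
         of_bool (\<forall>x\<in>set xs. x \<le> 1) * of_bool (sum_list xs + k = Suc n) +
         m * (of_bool (\<forall>x\<in>set xs. x \<le> 1) * of_bool (sum_list xs + m = Suc n))"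
        using Suc by auto
    qed
    also have "\<dots> = Stirling (Suc (Suc n)) m"
      using Suc.IH[of k] Suc.IH[of m] Suc by (simp add: sum_list_addf sum_list_const_mult)
    finally show ?thesis .
  qed
qed

section \<open>The vectors of (i) and (ii) as conditions on histories\<close>

lemma le_1_list:
  assumes "\<forall>x\<in>set xs. x \<le> 1"
  shows "sum_list xs \<le> length xs \<and>
    count_list xs i = (length xs - sum_list xs) * unit_vec 0 i + sum_list xs * unit_vec 1 i"
  using assms
proof (induction xs)
  case (Cons x xs)
  hence "x = 0 \<or> x = 1" and IH: "sum_list xs \<le> length xs"
    "count_list xs i = (length xs - sum_list xs) * unit_vec 0 i + sum_list xs * unit_vec 1 i"
    by auto
  thus ?case by (elim disjE; cases "i = 0") (simp_all add: unit_vec_def Suc_diff_le)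
qed simp

lemma gamma_one_nonzero:
  assumes "1 \<le> m" "m \<le> n"
  shows "gamma (Suc n) (\<lambda>i. (n - 1) * unit_vec 0 i + unit_vec m i) = (of_nat (Suc n choose Suc m) :: 'k::field_char_0)"
proof -
  have "count_list xs = (\<lambda>i. (n - 1) * unit_vec 0 i + unit_vec m i) \<longleftrightarrow>
      Suc (count_list xs 0) = n \<and> sum_list xs = m" if "xs \<in> set (histories n)" for xs
  proof
    have l: "length xs = n" using histories_length_sum that by blast
    show "count_list xs = (\<lambda>i. (n - 1) * unit_vec 0 i + unit_vec m i)"
      if "Suc (count_list xs 0) = n \<and> sum_list xs = m"
      using one_nonzero_list[of xs] l that by (intro ext) simp
    assume c: "count_list xs = (\<lambda>i. (n - 1) * unit_vec 0 i + unit_vec m i)"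
    \<comment> \<open>As m is positive, \<open>unit_vec m\<close> contributes nothing at index
      0.\<close>
    have z: "Suc (count_list xs 0) = n" using c assms by (simp add: unit_vec_def)
    \<comment> \<open>Evaluation at index m: the single nonzero entry is \<open>sum_list xs\<close>,
      so it must be m.\<close>
    have "(n - 1) * unit_vec 0 m + unit_vec (sum_list xs) m = (n - 1) * unit_vec 0 m + unit_vec m m"
      using one_nonzero_list[of xs m] z l fun_cong[OF c, of m] by metis
    hence "unit_vec (sum_list xs) m = 1" by (simp only: add_left_cancel) (simp add: unit_vec_def)
    hence "sum_list xs = m" unfolding unit_vec_def by presburger
    thus "Suc (count_list xs 0) = n \<and> sum_list xs = m" using z by blast
  qed
  hence "history_count n (\<lambda>i. (n - 1) * unit_vec 0 i + unit_vec m i) =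
      (\<Sum>xs\<leftarrow>histories n. of_bool (Suc (count_list xs 0) = n \<and> sum_list xs = m))"
    unfolding history_count_def by (intro arg_cong[of _ _ sum_list] map_cong) auto
  thus ?thesis using histories_one_nonzero[of m n] assms by (simp add: gamma_eq_history_count)
qed

lemma gamma_le_1:
  assumes "1 \<le> m" "m \<le> Suc n"
  shows "gamma (Suc n) (\<lambda>i. (m - 1) * unit_vec 0 i + (Suc n - m) * unit_vec 1 i) =
    (of_nat (Stirling (Suc n) m) :: 'k::field_char_0)"
proof -
  let ?a = "\<lambda>i. (m - 1) * unit_vec 0 i + (Suc n - m) * unit_vec 1 i"
  have "count_list xs = ?a \<longleftrightarrow> (\<forall>x\<in>set xs. x \<le> 1) \<and> sum_list xs + m = Suc n"
    if "xs \<in> set (histories n)" for xs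
  proof
    have l: "length xs = n" using histories_length_sum that by blast
    show "count_list xs = ?a" if h: "(\<forall>x\<in>set xs. x \<le> 1) \<and> sum_list xs + m = Suc n"
    proof
      fix i
      have "length xs - sum_list xs = m - 1" "sum_list xs = Suc n - m" using h l by auto
      thus "count_list xs i = ?a i" using le_1_list[OF conjunct1[OF h], of i] by metis
    qed
    assume c: "count_list xs = ?a"
    have le: "\<forall>x\<in>set xs. x \<le> 1"
    proof
      fix x assume "x \<in> set xs"
      hence "?a x \<noteq> 0" using c count_list_0_iff by metis
      thus "x \<le> 1" by (auto simp: unit_vec_def split: if_splits)
    qed
    \<comment> \<open>In a list of zeros and ones the number of ones is the sum.\<close>
    have "count_list xs 1 = Suc n - m" using c by (simp add: unit_vec_def)
    hence "sum_list xs = Suc n - m" using le_1_list[OF le, of 1] by (simp add: unit_vec_def)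
    thus "(\<forall>x\<in>set xs. x \<le> 1) \<and> sum_list xs + m = Suc n" using le assms by simp
  qed
  hence "history_count n ?a =
      (\<Sum>xs\<leftarrow>histories n. of_bool ((\<forall>x\<in>set xs. x \<le> 1) \<and> sum_list xs + m = Suc n))"
    unfolding history_count_def by (intro arg_cong[of _ _ sum_list] map_cong) auto
  thus ?thesis unfolding gamma_eq_history_count histories_le_1 by simp
qed


section \<open>Eulerian numbers: descents against zeros\<close>

fun descents :: "'a::linorder list \<Rightarrow> nat" where
  "descents (x # y # zs) = of_bool (x > y) + descents (y # zs)"
| "descents _ = 0"

lemma descents_snoc:
  "descents (xs @ [x]) = descents xs + of_bool (xs \<noteq> [] \<and> last xs > x)"
  by (induction xs rule: descents.induct) auto

lemma descents_le_length: "descents xs \<le> length xs - 1"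
  by (induction xs rule: descents.induct) auto

definition insert_at :: "'a \<Rightarrow> nat \<Rightarrow> 'a list \<Rightarrow> 'a list" where
  "insert_at x k xs = take k xs @ x # drop k xs"

lemma insert_at_simps [simp]:
  "insert_at x 0 xs = x # xs"
  "insert_at x (Suc k) (y # ys) = y # insert_at x k ys"
  by (simp_all add: insert_at_def)

text \<open>A new maximum placed inside a descent or at the end keeps the number of descents; at any
  other gap, inside an ascent or in front of a nonempty list, it adds one.\<close>

lemma sum_descents_insert_max:
  fixes \<phi> :: "nat \<Rightarrow> nat"
  assumes "\<forall>x\<in>set xs. x < n"
  shows "(\<Sum>k\<le>length xs. \<phi> (descents (insert_at n k xs))) =
    Suc (descents xs) * \<phi> (descents xs) + (length xs - descents xs) * \<phi> (Suc (descents xs))"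
  using assms
proof (induction xs arbitrary: \<phi> rule: induct_list012)
  case (3 x y zs)
  define e d where "e = (of_bool (x > y) :: nat)" and "d = descents (y # zs)"
  \<comment> \<open>\<open>S\<close> collects the gaps behind y, which \<open>x # y # zs\<close> and
    \<open>y # zs\<close> share up to the shift \<open>e\<close>. Only the gaps before x and before
    y need separate treatment.\<close>
  define S where "S = (\<Sum>j\<le>length zs. \<phi> (e + descents (y # insert_at n j zs)))"
  have lt: "x < n" "y < n" "\<not> n < x" "\<not> n < y" using 3 by auto
  have "(\<Sum>k\<le>length (y # zs). \<phi> (e + descents (insert_at n k (y # zs)))) =
      Suc d * \<phi> (e + d) + (length (y # zs) - d) * \<phi> (e + Suc d)"
    using "3.IH"(2)[of "\<lambda>s. \<phi> (e + s)"] "3.prems" by (simp add: d_def)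
  hence IH: "\<phi> (e + Suc d) + S = Suc d * \<phi> (e + d) + (Suc (length zs) - d) * \<phi> (e + Suc d)"
    using lt by (simp add: S_def d_def sum.atMost_Suc_shift del: sum.atMost_Suc)
  have step: "descents (x # y # insert_at n j zs) = e + descents (y # insert_at n j zs)" for j
    by (simp add: e_def)
  have "(\<Sum>k\<le>length (x # y # zs). \<phi> (descents (insert_at n k (x # y # zs)))) =
      \<phi> (Suc (e + d)) + (\<phi> (Suc d) + S)"
    using lt by (simp add: S_def step sum.atMost_Suc_shift del: sum.atMost_Suc descents.simps)
      (simp add: d_def e_def)
  moreover obtain r where r: "length zs = d + r"
    using descents_le_length[of "y # zs"] by (auto simp: d_def le_iff_add)
  moreover have "descents (x # y # zs) = e + d" by (simp add: e_def d_def)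
  moreover have "e = 0 \<or> e = 1" by (simp add: e_def)
  ultimately show ?case using IH by (auto simp: algebra_simps)
qed auto

text \<open>The inverse deletes the largest entry and remembers its position.\<close>

lemma bij_betw_insert_max:
  "bij_betw (\<lambda>(xs, k). insert_at (Suc n) k xs)
     (permutations_of_set {1..n} \<times> {..n}) (permutations_of_set {1..Suc n})"
proof (rule bij_betwI')
  fix u v assume "u \<in> permutations_of_set {1..n} \<times> {..n}" "v \<in> permutations_of_set {1..n} \<times> {..n}"
  then obtain xs k ys j where uv: "u = (xs, k)" "v = (ys, j)"
    and xs: "set xs = {1..n}" "distinct xs" "k \<le> n" and ys: "set ys = {1..n}" "distinct ys" "j \<le> n"
    by (auto simp: permutations_of_set_def)
  have len: "length xs = n" "length ys = n"
    using xs ys distinct_card[of xs] distinct_card[of ys] by auto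
  have nin: "Suc n \<notin> set (take k xs)" "Suc n \<notin> set (take j ys)"
    "Suc n \<notin> set (drop k xs)" "Suc n \<notin> set (drop j ys)"
    using xs ys by (auto dest!: in_set_takeD in_set_dropD)
  have "xs = ys \<and> k = j" if "insert_at (Suc n) k xs = insert_at (Suc n) j ys"
  proof -
    have "take k xs = take j ys \<and> drop k xs = drop j ys"
      using that nin unfolding insert_at_def by (subst (asm) append_Cons_eq_iff) auto
    moreover from this have "k = j"
      using len xs(3) ys(3) by (metis length_take min_absorb2)
    ultimately show ?thesis by (metis append_take_drop_id)
  qed
  thus "((case u of (xs, k) \<Rightarrow> insert_at (Suc n) k xs) = (case v of (xs, k) \<Rightarrow> insert_at (Suc n) k xs)) = (u = v)"
    using uv by auto
next
  fix u assume "u \<in> permutations_of_set {1..n} \<times> {..n}"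
  then obtain xs k where u: "u = (xs, k)" and xs: "set xs = {1..n}" "distinct xs"
    by (auto simp: permutations_of_set_def)
  have "set (take k xs) \<union> set (drop k xs) = {1..n}"
    by (metis append_take_drop_id set_append xs(1))
  hence "set (insert_at (Suc n) k xs) = {1..Suc n}"
    unfolding insert_at_def by auto
  moreover have "distinct (insert_at (Suc n) k xs)"
    unfolding insert_at_def using xs set_take_disj_set_drop_if_distinct[of xs k k]
    by (auto dest!: in_set_takeD in_set_dropD)
  ultimately show "(case u of (xs, k) \<Rightarrow> insert_at (Suc n) k xs) \<in> permutations_of_set {1..Suc n}"
    using u by (auto simp: permutations_of_set_def)
next
  fix ys assume "ys \<in> permutations_of_set {1..Suc n}"
  hence ys: "set ys = {1..Suc n}" "distinct ys" by (auto dest: permutations_of_setD)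
  then obtain us vs where uv: "ys = us @ Suc n # vs"
    by (metis atLeastAtMost_iff le_add1 le_refl plus_1_eq_Suc split_list)
  have "distinct (us @ vs)" "Suc n \<notin> set (us @ vs)" using ys uv by auto
  moreover have s: "set (us @ vs) = {1..n}"
  proof -
    have "set (us @ vs) = set ys - {Suc n}" using uv ys(2) by auto
    thus ?thesis using ys(1) by auto
  qed
  moreover have "length us \<le> n"
    using calculation distinct_card[of "us @ vs"] by simp
  ultimately have "(us @ vs, length us) \<in> permutations_of_set {1..n} \<times> {..n}"
    by (auto simp: permutations_of_set_def)
  moreover have "ys = (case (us @ vs, length us) of (xs, k) \<Rightarrow> insert_at (Suc n) k xs)"
    by (simp add: uv insert_at_def)
  ultimately show "\<exists>u\<in>permutations_of_set {1..n} \<times> {..n}. ys = (case u of (xs, k) \<Rightarrow> insert_at (Suc n) k xs)"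
    by blast
qed

lemma sum_descents_permutations_Suc:
  fixes \<phi> :: "nat \<Rightarrow> nat"
  shows "(\<Sum>ys\<in>permutations_of_set {1..Suc n}. \<phi> (descents ys)) =
    (\<Sum>xs\<in>permutations_of_set {1..n}.
       Suc (descents xs) * \<phi> (descents xs) + (n - descents xs) * \<phi> (Suc (descents xs)))"
proof -
  have "(\<Sum>ys\<in>permutations_of_set {1..Suc n}. \<phi> (descents ys)) =
      (\<Sum>(xs, k)\<in>permutations_of_set {1..n} \<times> {..n}. \<phi> (descents (insert_at (Suc n) k xs)))"
    using sum.reindex_bij_betw[OF bij_betw_insert_max, of "\<lambda>ys. \<phi> (descents ys)" n]
    by (simp add: case_prod_unfold)
  also have "\<dots> = (\<Sum>xs\<in>permutations_of_set {1..n}. \<Sum>k\<le>n. \<phi> (descents (insert_at (Suc n) k xs)))"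
    by (simp add: sum.cartesian_product)
  also have "\<dots> = (\<Sum>xs\<in>permutations_of_set {1..n}.
       Suc (descents xs) * \<phi> (descents xs) + (n - descents xs) * \<phi> (Suc (descents xs)))"
  proof (intro sum.cong refl)
    fix xs assume "xs \<in> permutations_of_set {1..n}"
    hence xs: "set xs = {1..n}" "distinct xs" by (auto dest: permutations_of_setD)
    hence "length xs = n" using distinct_card[of xs] by simp
    thus "(\<Sum>k\<le>n. \<phi> (descents (insert_at (Suc n) k xs))) =
       Suc (descents xs) * \<phi> (descents xs) + (n - descents xs) * \<phi> (Suc (descents xs))"
      using sum_descents_insert_max[of xs "Suc n" \<phi>] xs by simp
  qed
  finally show ?thesis .
qed

text \<open>Both statistics obey one rule: in the step to \<open>Suc n\<close>, a value z stays in z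
  + 1 ways and becomes z + 1 in \<open>Suc n - z\<close> ways. For histories the latter are raising
  nothing, which keeps the prepended 0, and raising one of the n - z nonzero entries. The weight
  \<open>\<phi>\<close> is arbitrary because the induction hypothesis is used at a transformed
  weight.\<close>

lemma sum_descents_eq_sum_zeros:
  fixes \<phi> :: "nat \<Rightarrow> nat"
  shows "(\<Sum>ys\<in>permutations_of_set {1..Suc n}. \<phi> (descents ys)) =
    (\<Sum>xs\<leftarrow>histories n. \<phi> (count_list xs 0))"
proof (induction n arbitrary: \<phi>)
  case 0
  show ?case by simp
next
  case (Suc n)
  have "(\<Sum>ys\<in>permutations_of_set {1..Suc (Suc n)}. \<phi> (descents ys)) =
      (\<Sum>xs\<leftarrow>histories n. Suc (count_list xs 0) * \<phi> (count_list xs 0) +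
        (Suc n - count_list xs 0) * \<phi> (Suc (count_list xs 0)))"
    unfolding sum_descents_permutations_Suc[of \<phi> "Suc n"] by (rule Suc.IH)
  also have "\<dots> = (\<Sum>xs\<leftarrow>histories (Suc n). \<phi> (count_list xs 0))"
    unfolding sum_histories_zeros[of "\<lambda>z s. \<phi> z"]
  proof (intro arg_cong[of _ _ sum_list] map_cong refl)
    fix xs assume "xs \<in> set (histories n)"
    then have "count_list xs 0 \<le> n" using histories_length_sum count_le_length by metis
    thus "Suc (count_list xs 0) * \<phi> (count_list xs 0) +
        (Suc n - count_list xs 0) * \<phi> (Suc (count_list xs 0)) =
        \<phi> (Suc (count_list xs 0)) + Suc (count_list xs 0) * \<phi> (count_list xs 0) +
        (n - count_list xs 0) * \<phi> (Suc (count_list xs 0))"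
      by (simp add: Suc_diff_le)
  qed
  finally show ?case .
qed

lemma descents_map_upt:
  fixes f :: "nat \<Rightarrow> 'a::linorder"
  shows "descents (map f [a..<b]) = card {i. a \<le> i \<and> Suc i < b \<and> f i > f (Suc i)}"
proof (induction b)
  case (Suc b)
  let ?D = "\<lambda>b. {i. a \<le> i \<and> Suc i < b \<and> f i > f (Suc i)}"
  show ?case
  proof (cases "a < b")
    case True
    then obtain c where c: "b = Suc c" "a \<le> c" by (cases b) auto
    have "?D (Suc b) = (if f c > f b then insert c (?D b) else ?D b)"
      using c by (auto simp: less_Suc_eq)
    moreover have "finite (?D b)" by (rule finite_subset[of _ "{..<b}"]) auto
    moreover have "c \<notin> ?D b" using c by simp
    moreover have "descents (map f [a..<Suc b]) = descents (map f [a..<b]) + of_bool (f c > f b)"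
    proof -
      have "map f [a..<Suc b] = map f [a..<b] @ [f b]" using True by simp
      moreover have "map f [a..<b] \<noteq> []" "last (map f [a..<b]) = f c" using c by simp_all
      ultimately show ?thesis by (simp only: descents_snoc) simp
    qed
    ultimately show ?thesis using Suc.IH by simp
  next
    case False
    hence "?D (Suc b) = {}" by auto
    moreover have "descents (map f [a..<Suc b]) = 0" using False by (cases "a = b") auto
    ultimately show ?thesis by simp
  qed
qed simp

text \<open>One-line notation, needed because \<open>eulerian\<close> counts functions while the
  insertion argument works on lists.\<close>

lemma bij_betw_permutes_lists:
  "bij_betw (\<lambda>\<pi>. map \<pi> [1..<Suc p]) {\<pi>. \<pi> permutes {1..p}} (permutations_of_set {1..p})"
proof (rule bij_betwI')
  fix \<pi> \<rho> assume \<pi>: "\<pi> \<in> {\<pi>. \<pi> permutes {1..p}}" and \<rho>: "\<rho> \<in> {\<pi>. \<pi> permutes {1..p}}"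
  have "\<pi> = \<rho>" if eq: "map \<pi> [1..<Suc p] = map \<rho> [1..<Suc p]"
  proof
    fix i show "\<pi> i = \<rho> i"
    proof (cases "i \<in> {1..p}")
      case True
      hence "i \<in> set [1..<Suc p]" by auto
      thus ?thesis using eq map_eq_conv by metis
    next
      case False
      thus ?thesis using \<pi> \<rho> by (simp add: permutes_def)
    qed
  qed
  thus "(map \<pi> [1..<Suc p] = map \<rho> [1..<Suc p]) = (\<pi> = \<rho>)" by blast
next
  fix \<pi> assume "\<pi> \<in> {\<pi>. \<pi> permutes {1..p}}"
  hence \<pi>: "\<pi> permutes {1..p}" by simp
  have "{1..<Suc p} = {1..p}" by auto
  thus "map \<pi> [1..<Suc p] \<in> permutations_of_set {1..p}"
    using permutes_image[OF \<pi>] permutes_inj_on[OF \<pi>]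
    by (intro permutations_of_setI) (simp_all add: distinct_map del: upt_Suc)
next
  fix ys assume "ys \<in> permutations_of_set {1..p}"
  hence ys: "set ys = {1..p}" "distinct ys" by (auto dest: permutations_of_setD)
  have len: "length ys = p" using ys distinct_card[of ys] by simp
  define \<pi> where "\<pi> i = (if i \<in> {1..p} then ys ! (i - 1) else i)" for i
  have map: "map \<pi> [1..<Suc p] = ys"
    by (rule nth_equalityI) (auto simp: len \<pi>_def simp del: upt_Suc)
  have s: "set [1..<Suc p] = {1..p}" by auto
  have "bij_betw \<pi> {1..p} {1..p}"
    using ys map s unfolding bij_betw_def by (metis distinct_map list.set_map)
  hence "\<pi> permutes {1..p}" by (rule bij_imp_permutes) (auto simp: \<pi>_def)
  thus "\<exists>\<pi>\<in>{\<pi>. \<pi> permutes {1..p}}. ys = map \<pi> [1..<Suc p]" using map by blast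
qed

lemma eulerian_eq_sum_descents:
  "eulerian p m = (\<Sum>xs\<in>permutations_of_set {1..p}. of_bool (descents xs = m))"
proof -
  have "eulerian p m = card {\<pi>\<in>{\<pi>. \<pi> permutes {1..p}}. descents (map \<pi> [1..<Suc p]) = m}"
    unfolding eulerian_def descents_map_upt by simp
  also have "\<dots> = (\<Sum>\<pi> | \<pi> permutes {1..p}. of_bool (descents (map \<pi> [1..<Suc p]) = m))"
    by (simp add: finite_permutations Int_def del: upt_Suc)
  also have "\<dots> = (\<Sum>xs\<in>permutations_of_set {1..p}. of_bool (descents xs = m))"
    by (rule sum.reindex_bij_betw[OF bij_betw_permutes_lists])
  finally show ?thesis .
qed

theorem corollary12:
  fixes p :: nat
  assumes "p > 0"
  shows "(\<forall>m. 1 \<le> m \<and> m \<le> p - 1 \<longrightarrow>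
            (gamma p (\<lambda>i. (p - 2) * unit_vec 0 i + unit_vec m i) :: 'k::field_char_0)
              = of_nat (p choose (m + 1)))
       \<and> (\<forall>m. 1 \<le> m \<and> m \<le> p \<longrightarrow>
            (gamma p (\<lambda>i. (m - 1) * unit_vec 0 i + (p - m) * unit_vec 1 i) :: 'k)
              = of_nat (Stirling p m))
       \<and> (\<forall>m. 1 \<le> m \<and> m \<le> p \<longrightarrow>
            (\<Sum>a | a \<in> Lambda p \<and> weight a = p - m. gamma p a :: 'k) = of_nat (stirling p m))
       \<and> (\<forall>m. m \<le> p - 1 \<longrightarrow>
            (\<Sum>a | a \<in> Lambda p \<and> a 0 = m. gamma p a :: 'k) = of_nat (eulerian p m))"
proof -
  obtain n where p: "p = Suc n" using assms by (cases p) auto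
  have 1: "gamma p (\<lambda>i. (p - 2) * unit_vec 0 i + unit_vec m i) = (of_nat (p choose (m + 1)) :: 'k)"
    if "1 \<le> m \<and> m \<le> p - 1" for m
    using gamma_one_nonzero[of m n] that by (simp add: p)
  have 2: "gamma p (\<lambda>i. (m - 1) * unit_vec 0 i + (p - m) * unit_vec 1 i) = (of_nat (Stirling p m) :: 'k)"
    if "1 \<le> m \<and> m \<le> p" for m
    using gamma_le_1[of m n] that unfolding p by blast
  have 3: "(\<Sum>a | a \<in> Lambda p \<and> weight a = p - m. gamma p a :: 'k) = of_nat (stirling p m)"
    if "1 \<le> m \<and> m \<le> p" for m
  proof -
    \<comment> \<open>Since m is at most p, the difference is not truncated and the additive
      condition is equivalent.\<close>
    have "sum_list xs = Suc n - m \<longleftrightarrow> sum_list xs + m = Suc n" for xs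
      using that p by auto
    thus ?thesis unfolding p sum_gamma weight_count_list by (simp only: histories_by_sum)
  qed
  have 4: "(\<Sum>a | a \<in> Lambda p \<and> a 0 = m. gamma p a :: 'k) = of_nat (eulerian p m)" for m
    unfolding p sum_gamma eulerian_eq_sum_descents
      sum_descents_eq_sum_zeros[of "\<lambda>z. of_bool (z = m)"] ..
  show ?thesis using 1 2 3 4 by blast
qed

end
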